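(* Let $\mathcal M$ be a set of POVMs on a finite-dimensional Hilbert space, and define $C_{\mathcal M}:=\bigcup_{M\in\mathcal M}\operatorname{cone}\{M^z\}_z$, the union of the cones spanned by the POVM elements of measurements in $\mathcal M$. Then, for every quantum state $\rho$ and every $\sigma\geq0$, $$D_{\mathcal M}(\rho\|\sigma)\;\leq\;\sup_{\substack{\omega>0\\ \omega\in C_{\mathcal M}}}\big\{\operatorname{tr}[\rho\log\omega]-\log\operatorname{tr}[\sigma\omega]\big\}.$$
   Context: Quantum states are positive semidefinite operators of unit trace; $\omega>0$ means positive semidefinite with full support; $\log$ is the natural logarithm. A POVM is a finite family $M=\{M^z\}_z$ of positive semidefinite operators with $\sum_zM^z=1$; $\operatorname{cone}\{M^z\}_z$ is the set of all nonnegative linear combinations of the $M^z$. The measured relative entropy is $D_{\mathcal M}(\rho\|\sigma)=\sup_{M\in\mathcal M}D(\mathbb P_{\rho,M}\|\mathbb P_{\sigma,M})$, where $\mathbb P_{\rho,M}(z)=\operatorname{tr}[\rho M^z]$ and $D(P\|Q)=\sum_zP(z)\log\frac{P(z)}{Q(z)}$ (with $0\log\frac{0}{q}=0$, and $D(P\|Q)=+\infty$ if $P(z)>0=Q(z)$ for some $z$). Both sides are allowed to be $+\infty$. *)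

theory Defs
  imports "HOL-Analysis.Analysis"
begin

text \<open>
  An arbitrary nonzero finite-dimensional Hilbert space is taken to be \<open>complex ^ 'n\<close>, and its
  operators are the matrices \<open>complex ^ 'n ^ 'n\<close>. (The zero space carries no states.)
\<close>

type_synonym 'n cmat = "complex ^ 'n ^ 'n"

definition cinner :: "complex ^ 'n \<Rightarrow> complex ^ 'n \<Rightarrow> complex" where
  "cinner v w = (\<Sum>i\<in>UNIV. cnj (v $ i) * w $ i)"

definition dagger :: "('n::finite) cmat \<Rightarrow> 'n cmat" where
  "dagger A = map_matrix cnj (transpose A)"

definition hermitian :: "('n::finite) cmat \<Rightarrow> bool" where
  "hermitian A \<longleftrightarrow> dagger A = A"

definition unitary :: "('n::finite) cmat \<Rightarrow> bool" where
  "unitary U \<longleftrightarrow> dagger U ** U = mat 1 \<and> U ** dagger U = mat 1"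

definition psd :: "('n::finite) cmat \<Rightarrow> bool" where
  "psd A \<longleftrightarrow> hermitian A \<and> (\<forall>v. 0 \<le> Re (cinner v (A *v v)))"

text \<open>
  The support of a Hermitian operator is the orthogonal complement of its kernel, so full support
  means trivial kernel.
\<close>

definition psd_full_support :: "('n::finite) cmat \<Rightarrow> bool" where
  "psd_full_support A \<longleftrightarrow> psd A \<and> (\<forall>v. A *v v = 0 \<longrightarrow> v = 0)"

definition quantum_state :: "('n::finite) cmat \<Rightarrow> bool" where
  "quantum_state \<rho> \<longleftrightarrow> psd \<rho> \<and> trace \<rho> = 1"

definition real_diag :: "('n::finite \<Rightarrow> real) \<Rightarrow> 'n cmat" where
  "real_diag d = (\<chi> i j. if i = j then complex_of_real (d i) else 0)"

text \<open>
  Functional calculus for Hermitian matrices: apply \<open>f\<close> to the eigenvalues in any unitary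
  diagonalisation. The result does not depend on the diagonalisation, see \<open>hermitian_fun_eq\<close>
  below. The value is unspecified if \<open>A\<close> is not Hermitian.
\<close>

definition hermitian_fun :: "(real \<Rightarrow> real) \<Rightarrow> ('n::finite) cmat \<Rightarrow> 'n cmat" where
  "hermitian_fun f A =
     (THE B. \<exists>U d. unitary U \<and> A = U ** real_diag d ** dagger U \<and>
                   B = U ** real_diag (\<lambda>i. f (d i)) ** dagger U)"

definition mat_log :: "('n::finite) cmat \<Rightarrow> 'n cmat" where
  "mat_log A = hermitian_fun ln A"

lemma real_diag_mult_nth:
  "(real_diag d ** A) $ i $ j = complex_of_real (d i) * A $ i $ j"
  "(A ** real_diag d) $ i $ j = A $ i $ j * complex_of_real (d j)"
  by (simp_all add: real_diag_def matrix_matrix_mult_def if_distrib if_distribR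
        sum.delta sum.delta' cong: if_cong)

lemma unitary_diagonalisation_unique:
  assumes U: "unitary U" and V: "unitary V"
    and eq: "U ** real_diag d ** dagger U = V ** real_diag e ** dagger V"
  shows "U ** real_diag (\<lambda>i. f (d i)) ** dagger U = V ** real_diag (\<lambda>i. f (e i)) ** dagger V"
proof -
  define W where "W = dagger V ** U"
  have UU: "dagger U ** U = mat 1" "U ** dagger U = mat 1"
    and VV: "dagger V ** V = mat 1" "V ** dagger V = mat 1"
    using U V by (auto simp: unitary_def)
  have "W ** real_diag d = dagger V ** (U ** real_diag d ** dagger U) ** U"
    by (simp add: W_def matrix_mul_assoc[symmetric] UU)
  also have "\<dots> = dagger V ** (V ** real_diag e ** dagger V) ** U"
    by (simp add: eq)
  also have "\<dots> = (dagger V ** V) ** real_diag e ** (dagger V ** U)"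
    by (simp only: matrix_mul_assoc)
  also have "\<dots> = real_diag e ** W"
    by (simp add: W_def VV)
  finally have "W $ i $ j * of_real (d j) = of_real (e i) * W $ i $ j" for i j
    by (metis real_diag_mult_nth)
  then have "W $ i $ j = 0 \<or> d j = e i" for i j
    by (metis mult.commute mult_cancel_right of_real_eq_iff)
  then have "W $ i $ j * of_real (f (d j)) = of_real (f (e i)) * W $ i $ j" for i j
    by (metis mult.commute mult_zero_left)
  then have *: "W ** real_diag (\<lambda>i. f (d i)) = real_diag (\<lambda>i. f (e i)) ** W"
    by (simp add: vec_eq_iff real_diag_mult_nth)
  have "U ** real_diag (\<lambda>i. f (d i)) ** dagger U
      = (V ** dagger V) ** U ** real_diag (\<lambda>i. f (d i)) ** dagger U"
    by (simp add: VV)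
  also have "\<dots> = V ** (W ** real_diag (\<lambda>i. f (d i))) ** dagger U"
    by (simp only: W_def matrix_mul_assoc)
  also have "\<dots> = V ** (real_diag (\<lambda>i. f (e i)) ** W) ** dagger U"
    by (simp only: *)
  also have "\<dots> = V ** real_diag (\<lambda>i. f (e i)) ** dagger V ** (U ** dagger U)"
    by (simp only: W_def matrix_mul_assoc)
  finally show ?thesis
    by (simp add: UU)
qed

lemma hermitian_fun_eq:
  assumes "unitary U" and "A = U ** real_diag d ** dagger U"
  shows "hermitian_fun f A = U ** real_diag (\<lambda>i. f (d i)) ** dagger U"
  unfolding hermitian_fun_def
proof (rule the_equality)
  show "\<exists>U' d'. unitary U' \<and> A = U' ** real_diag d' ** dagger U' \<and>
      U ** real_diag (\<lambda>i. f (d i)) ** dagger U = U' ** real_diag (\<lambda>i. f (d' i)) ** dagger U'"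
    using assms by blast
next
  fix B
  assume "\<exists>V e. unitary V \<and> A = V ** real_diag e ** dagger V \<and>
      B = V ** real_diag (\<lambda>i. f (e i)) ** dagger V"
  then obtain V e where "unitary V" and "A = V ** real_diag e ** dagger V"
    and B: "B = V ** real_diag (\<lambda>i. f (e i)) ** dagger V"
    by blast
  then show "B = U ** real_diag (\<lambda>i. f (d i)) ** dagger U"
    using unitary_diagonalisation_unique[OF assms(1) \<open>unitary V\<close>] assms(2) by metis
qed

text \<open>
  A finite family of operators is its outcome set \<open>Z\<close> together with the map \<open>z \<mapsto> M z\<close>; values
  outside \<open>Z\<close> are irrelevant. Different POVMs may have different outcome sets.
\<close>

type_synonym ('z, 'n) opfam = "'z set \<times> ('z \<Rightarrow> 'n cmat)"

fun POVM :: "('z, 'n::finite) opfam \<Rightarrow> bool" where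
  "POVM (Z, M) \<longleftrightarrow> finite Z \<and> (\<forall>z\<in>Z. psd (M z)) \<and> (\<Sum>z\<in>Z. M z) = mat 1"

fun cone_of :: "('z, 'n::finite) opfam \<Rightarrow> 'n cmat set" where
  "cone_of (Z, M) = {\<Sum>z\<in>Z. c z *\<^sub>R M z | c. \<forall>z\<in>Z. (0::real) \<le> c z}"

definition cone_union :: "('z, 'n::finite) opfam set \<Rightarrow> 'n cmat set" where
  "cone_union \<M> = (\<Union>M\<in>\<M>. cone_of M)"

text \<open>
  On positive semidefinite arguments the trace of a product is a nonnegative real; \<open>Re\<close> below only
  changes the type.
\<close>

definition outcome_prob :: "('n::finite) cmat \<Rightarrow> ('z \<Rightarrow> 'n cmat) \<Rightarrow> 'z \<Rightarrow> real" where
  "outcome_prob \<rho> M z = Re (trace (\<rho> ** M z))"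

text \<open>
  The conventions \<open>0 * ln (0 / q) = 0\<close>, also for \<open>q = 0\<close>, hold automatically.
\<close>

definition rel_entropy :: "'z set \<Rightarrow> ('z \<Rightarrow> real) \<Rightarrow> ('z \<Rightarrow> real) \<Rightarrow> ereal" where
  "rel_entropy Z P Q =
     (if \<exists>z\<in>Z. P z > 0 \<and> Q z = 0 then \<infinity> else ereal (\<Sum>z\<in>Z. P z * ln (P z / Q z)))"

definition measured_rel_entropy ::
    "('z, 'n::finite) opfam set \<Rightarrow> 'n cmat \<Rightarrow> 'n cmat \<Rightarrow> ereal" where
  "measured_rel_entropy \<M> \<rho> \<sigma> =
     (SUP (Z, M) \<in> \<M>. rel_entropy Z (outcome_prob \<rho> M) (outcome_prob \<sigma> M))"

text \<open>Natural logarithm of a nonnegative real, with \<open>log 0 = -\<infinity>\<close> (needed for \<open>\<sigma> = 0\<close>).\<close>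

definition elog :: "real \<Rightarrow> ereal" where
  "elog x = (if x = 0 then -\<infinity> else ereal (ln x))"

end

theory Submission
  imports Defs "HOL-Real_Asymp.Real_Asymp"
begin

text \<open>
  Given a POVM with outcome distributions \<open>P\<close> and \<open>Q\<close>, test with \<open>\<omega> = \<Sum>z\<in>Z. c z M z\<close>, where \<open>c z\<close>
  approximates the likelihood ratio \<open>P z / Q z\<close>. Then \<open>tr (\<sigma> \<omega>) = \<Sum>z\<in>Z. c z Q z\<close>, which is close
  to \<open>1\<close> when the relative entropy is finite, and Jensen's operator inequality gives
  \<open>tr (\<rho> log \<omega>) \<ge> \<Sum>z\<in>Z. P z ln (c z)\<close>. Jensen's inequality for the logarithm follows from the one
  for the inverses \<open>1 / (x + s)\<close>, a completion of squares, by monotonicity in \<open>s\<close> and comparison at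
  \<open>s \<rightarrow> \<infinity>\<close>.
\<close>

section \<open>The spectral theorem for Hermitian matrices\<close>

text \<open>This lets the spectral theorem be argued in the underlying real Euclidean space:
  Hermitian matrices are self-adjoint for \<open>\<bullet>\<close>, and their eigenvalues are real
  scalars.\<close>

lemma Re_cinner: "Re (cinner v w) = v \<bullet> w"
  by (simp add: cinner_def inner_vec_def inner_complex_def)

lemma cinner_zero_right [simp]: "cinner v 0 = 0"
  by (simp add: cinner_def)

lemma cinner_add_right: "cinner v (w + x) = cinner v w + cinner v x"
  by (simp add: cinner_def algebra_simps sum.distrib)

lemma cinner_scaleR_right: "cinner v (r *\<^sub>R w) = r *\<^sub>R cinner v w"
  by (simp add: cinner_def scaleR_sum_right)

lemma cinner_scaleR_left: "cinner (r *\<^sub>R v) w = r *\<^sub>R cinner v w"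
  by (simp add: cinner_def scaleR_sum_right)

lemma cnj_cinner: "cnj (cinner v w) = cinner w v"
  by (simp add: cinner_def mult.commute)

lemma cinner_self: "cinner v v = complex_of_real (v \<bullet> v)"
  using Re_cinner[of v v] cnj_cinner[of v v] by (simp add: complex_eq_iff)

lemma dagger_nth: "dagger A $ i $ j = cnj (A $ j $ i)"
  by (simp add: dagger_def map_matrix_def transpose_def)

lemma cinner_dagger_left: "cinner (dagger A *v v) w = cinner v (A *v w)"
proof -
  have "cinner (dagger A *v v) w = (\<Sum>i\<in>UNIV. \<Sum>j\<in>UNIV. cnj (v $ j) * A $ j $ i * w $ i)"
    by (simp add: cinner_def matrix_vector_mult_def dagger_nth sum_distrib_right sum_distrib_left mult_ac)
  also have "\<dots> = cinner v (A *v w)"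
    by (subst sum.swap)
      (simp add: cinner_def matrix_vector_mult_def sum_distrib_right sum_distrib_left mult_ac)
  finally show ?thesis .
qed

lemma hermitian_cinner: "hermitian A \<Longrightarrow> cinner (A *v v) w = cinner v (A *v w)"
  using cinner_dagger_left[of A v w] by (simp add: hermitian_def)

lemma hermitian_inner: "hermitian A \<Longrightarrow> (A *v v) \<bullet> w = v \<bullet> (A *v w)"
  by (metis hermitian_cinner Re_cinner)

lemma matrix_vector_mult_scaleR_complex:
  fixes A :: "complex ^ 'm ^ 'n"
  shows "A *v (r *\<^sub>R v) = r *\<^sub>R (A *v v)" and "(r *\<^sub>R A) *v v = r *\<^sub>R (A *v v)"
  by (simp_all add: matrix_vector_mult_def vec_eq_iff scaleR_sum_right)

lemma linear_matrix_vector_mult_complex: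
  fixes A :: "complex ^ 'm ^ 'n"
  shows "linear (\<lambda>v. A *v v)"
  by (rule linearI) (simp_all add: matrix_vector_mult_scaleR_complex matrix_vector_right_distrib)

text \<open>This is the first-order condition at a minimum at \<open>t = 0\<close>; it turns
  extremality of the quadratic form into an eigenvector equation.\<close>

lemma nonneg_quadratic_imp_linear_coeff_0:
  fixes b c :: real
  assumes "\<And>t. 0 \<le> 2 * t * b + t\<^sup>2 * c" and "0 \<le> c"
  shows "b = 0"
proof (rule ccontr)
  assume "b \<noteq> 0"
  \<comment> \<open>The test point is \<open>t = - b / (c + 1)\<close>; the added \<open>1\<close>
    keeps the denominator positive when \<open>c = 0\<close>.\<close>
  have "2 * (- b / k) * b + (- b / k)\<^sup>2 * (k - 1) = - b\<^sup>2 * (k + 1) / k\<^sup>2" if "0 < k" for k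
    using that by (simp add: field_simps power2_eq_square)
  from this[of "c + 1"]
  have "2 * (- b / (c + 1)) * b + (- b / (c + 1))\<^sup>2 * c = - b\<^sup>2 * (c + 2) / (c + 1)\<^sup>2"
    using assms(2) by simp
  also have "\<dots> < 0"
    using assms(2) \<open>b \<noteq> 0\<close> by (simp add: divide_neg_pos mult_neg_pos)
  finally show False
    using assms(1)[of "- b / (c + 1)"] by simp
qed

text \<open>
  The eigenvector maximises the quadratic form of \<open>f\<close> on the unit sphere of \<open>S\<close>.
\<close>

lemma self_adjoint_eigenvector:
  fixes f :: "'a::euclidean_space \<Rightarrow> 'a"
  assumes f: "linear f" and adj: "\<And>x y. f x \<bullet> y = x \<bullet> f y"
    and S: "subspace S" and inv: "\<And>x. x \<in> S \<Longrightarrow> f x \<in> S" and ne: "\<exists>x\<in>S. x \<noteq> 0"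
  obtains x l where "x \<in> S" "norm x = 1" "f x = l *\<^sub>R x"
proof -
  let ?K = "sphere 0 1 \<inter> S"
  obtain x0 where "x0 \<in> S" "x0 \<noteq> 0" using ne by blast
  then have "(1 / norm x0) *\<^sub>R x0 \<in> ?K"
    using S by (simp add: subspace_scale)
  then have "?K \<noteq> {}" by blast
  moreover have "compact ?K"
    by (simp add: S closed_subspace compact_Int_closed)
  moreover have "continuous_on ?K (\<lambda>x. x \<bullet> f x)"
    by (intro continuous_intros linear_continuous_on_compose[OF _ f])
  ultimately obtain x where x: "x \<in> ?K" and max: "\<And>y. y \<in> ?K \<Longrightarrow> y \<bullet> f y \<le> x \<bullet> f x"
    using continuous_attains_sup by metis
  have x1: "x \<in> S" "norm x = 1" using x by auto
  define l where "l = x \<bullet> f x"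
  define g where "g y = l *\<^sub>R y - f y" for y
  have g: "linear g"
    unfolding g_def by (intro linear_compose_sub linear_scale_self f)
  have gadj: "g y \<bullet> z = y \<bullet> g z" for y z
    by (simp add: g_def inner_diff_left inner_diff_right adj)
  have gS: "g y \<in> S" if "y \<in> S" for y
    using that S inv by (simp add: g_def subspace_diff subspace_scale)
  have gpos: "0 \<le> y \<bullet> g y" if y: "y \<in> S" for y
  proof (cases "y = 0")
    case False
    let ?z = "(1 / norm y) *\<^sub>R y"
    have "?z \<in> ?K" using y S False by (simp add: subspace_scale)
    from max[OF this] have "(y \<bullet> f y) / (norm y)\<^sup>2 \<le> l"
      by (simp add: l_def linear_scale[OF f] power2_eq_square)
    then show ?thesis
      using False by (simp add: g_def inner_diff_right divide_le_eq power2_norm_eq_inner)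
  qed simp
  have gx: "x \<bullet> g x = 0"
    using x1 by (simp add: g_def inner_diff_right l_def flip: power2_norm_eq_inner)
  \<comment> \<open>The form \<open>y \<bullet> g y\<close> is nonnegative on \<open>S\<close> and
    vanishes at \<open>x\<close>. Perturbing \<open>x\<close> along \<open>g x\<close>, which stays
    in \<open>S\<close>, has linear coefficient \<open>g x \<bullet> g x\<close>.\<close>
  have "g x \<bullet> g x = 0"
  proof (rule nonneg_quadratic_imp_linear_coeff_0)
    show "0 \<le> g x \<bullet> g (g x)" using gpos gS x1 by blast
    fix t
    have "x + t *\<^sub>R g x \<in> S" using S gS x1 by (simp add: subspace_add subspace_scale)
    from gpos[OF this] show "0 \<le> 2 * t * (g x \<bullet> g x) + t\<^sup>2 * (g x \<bullet> g (g x))"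
      using gx gadj[of x "g x"]
      by (simp add: linear_add[OF g] linear_scale[OF g] inner_add_left inner_add_right
          power2_eq_square algebra_simps)
  qed
  then have "f x = l *\<^sub>R x" by (simp add: g_def)
  with x1 that show ?thesis by blast
qed

text \<open>The conditions form a square homogeneous system whose row \<open>j\<close> is zero, so
  the matrix is singular and has a kernel vector.\<close>

lemma exists_nonzero_orthogonal:
  fixes u :: "'n::finite \<Rightarrow> complex ^ 'n"
  assumes "j \<notin> I"
  obtains v where "v \<noteq> 0" "\<forall>i\<in>I. cinner (u i) v = 0"
proof -
  define R where "R = ((\<chi> i k. if i \<in> I then cnj (u i $ k) else 0) :: complex ^ 'n ^ 'n)"
  have "(R ** B) $ j $ j \<noteq> mat 1 $ j $ j" for B
    using assms by (simp add: R_def matrix_matrix_mult_def mat_def)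
  then have "R ** B \<noteq> mat 1" for B by metis
  then have "\<nexists>B. B ** R = mat 1"
    by (simp add: matrix_left_right_inverse)
  then obtain v where v: "v \<noteq> 0" "R *v v = 0"
    using matrix_left_invertible_ker by blast
  have "cinner (u i) v = (R *v v) $ i" if "i \<in> I" for i
    using that by (simp add: R_def cinner_def matrix_vector_mult_def)
  then show ?thesis using v that by simp
qed

text \<open>Induction on \<open>I\<close>: the orthogonal complement of the eigenvectors found so
  far is nonzero and invariant, so it contains another one. Indexing by subsets of \<open>'n\<close>
  makes \<open>I = UNIV\<close> a full basis without a dimension count.\<close>

lemma hermitian_orthonormal_eigenvectors:
  fixes A :: "('n::finite) cmat" and I :: "'n set"
  assumes A: "hermitian A"
  shows "\<exists>u d. (\<forall>i\<in>I. \<forall>j\<in>I. cinner (u i) (u j) = (if i = j then 1 else 0)) \<and>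
           (\<forall>i\<in>I. A *v u i = (d i :: real) *\<^sub>R u i)"
  using finite[of I]
proof (induction I rule: finite_induct)
  case (insert k I)
  then obtain u and d :: "'n \<Rightarrow> real"
    where u: "\<And>i j. i \<in> I \<Longrightarrow> j \<in> I \<Longrightarrow> cinner (u i) (u j) = (if i = j then 1 else 0)"
      and d: "\<And>i. i \<in> I \<Longrightarrow> A *v u i = d i *\<^sub>R u i" by blast
  define S where "S = {v. \<forall>i\<in>I. cinner (u i) v = 0}"
  obtain v where "v \<noteq> 0" and v: "\<forall>i\<in>I. cinner (u i) v = 0"
    by (rule exists_nonzero_orthogonal[OF insert.hyps(2), of u])
  have "subspace S"
    by (auto simp: subspace_def S_def cinner_add_right cinner_scaleR_right)
  moreover have "A *v x \<in> S" if "x \<in> S" for x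
    \<comment> \<open>Moving \<open>A\<close> onto \<open>u i\<close> produces the factor
      \<open>d i\<close> times \<open>cinner (u i) x = 0\<close>.\<close>
    using that by (simp add: S_def flip: hermitian_cinner[OF A]) (simp add: d cinner_scaleR_left)
  moreover have "\<exists>v\<in>S. v \<noteq> 0"
    using \<open>v \<noteq> 0\<close> v by (auto simp: S_def)
  ultimately obtain x l where x: "x \<in> S" "norm x = 1" "A *v x = l *\<^sub>R x"
    by (rule self_adjoint_eigenvector[OF linear_matrix_vector_mult_complex hermitian_inner[OF A]])
  have xx: "cinner x x = 1"
    using x(2) by (simp add: cinner_self flip: power2_norm_eq_inner)
  have ux: "cinner (u i) x = 0" "cinner x (u i) = 0" if "i \<in> I" for i
    using x(1) that cnj_cinner[of "u i" x] by (auto simp: S_def)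
  have "\<forall>i\<in>insert k I. \<forall>j\<in>insert k I.
      cinner ((u(k := x)) i) ((u(k := x)) j) = (if i = j then 1 else 0)"
    using u ux xx insert.hyps(2) by auto
  moreover have "\<forall>i\<in>insert k I. A *v (u(k := x)) i = (d(k := l)) i *\<^sub>R (u(k := x)) i"
    using d x(3) by auto
  ultimately show ?case by blast
qed simp

lemma dagger_mult_mult_nth:
  "(dagger U ** A ** U) $ i $ j = cinner (column i U) (A *v column j U)"
  by (simp add: cinner_def matrix_matrix_mult_def matrix_vector_mult_def dagger_nth column_def
      sum_distrib_left sum_distrib_right mult.assoc) (rule sum.swap)

lemma hermitian_spectral:
  assumes "hermitian A"
  obtains U d where "unitary U" "A = U ** real_diag d ** dagger U"
proof -
  obtain u and d :: "'a \<Rightarrow> real"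
    where u: "\<And>i j. cinner (u i) (u j) = (if i = j then 1 else 0)"
      and d: "\<And>i. A *v u i = d i *\<^sub>R u i"
    using hermitian_orthonormal_eigenvectors[OF assms, of UNIV] by blast
  define U :: "'a cmat" where "U = (\<chi> i j. u j $ i)"
  have col: "column j U = u j" for j
    by (simp add: column_def U_def vec_eq_iff)
  \<comment> \<open>The entries are the Gram matrix of the columns, obtained by conjugating
    \<open>mat 1\<close>.\<close>
  have "dagger U ** U = mat 1"
    using dagger_mult_mult_nth[of U "mat 1"] by (simp add: vec_eq_iff col u) (simp add: mat_def)
  then have U: "dagger U ** U = mat 1" "U ** dagger U = mat 1"
    using matrix_left_right_inverse by blast+
  have "dagger U ** A ** U = real_diag d"
    using dagger_mult_mult_nth[of U A]
    by (simp add: vec_eq_iff col d cinner_scaleR_right u) (simp add: real_diag_def scaleR_conv_of_real)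
  then have "A = U ** real_diag d ** dagger U"
    by (metis U(2) matrix_mul_assoc matrix_mul_lid matrix_mul_rid)
  with U that show ?thesis by (simp add: unitary_def)
qed

section \<open>Jensen's inequality for the logarithm\<close>

lemma psd_inner: "psd A \<Longrightarrow> 0 \<le> v \<bullet> (A *v v)"
  by (simp add: psd_def Re_cinner)

lemma trace_unitary_conjugate:
  "trace (U ** real_diag d ** dagger U ** X)
    = (\<Sum>k\<in>UNIV. d k *\<^sub>R cinner (column k U) (X *v column k U))"
proof -
  have "trace (U ** real_diag d ** dagger U ** X) = trace (real_diag d ** (dagger U ** X ** U))"
    by (simp only: matrix_mul_assoc[symmetric] trace_mul_sym[of U])
  then show ?thesis
    by (simp add: trace_def real_diag_mult_nth dagger_mult_mult_nth scaleR_conv_of_real)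
qed

lemma eigenvalue_eq_inner:
  assumes U: "unitary U" and A: "A = U ** real_diag d ** dagger U"
  shows "d k = column k U \<bullet> (A *v column k U)"
proof -
  have "dagger U ** A ** U = (dagger U ** U) ** real_diag d ** (dagger U ** U)"
    unfolding A by (simp only: matrix_mul_assoc)
  then have "(dagger U ** A ** U) $ k $ k = real_diag d $ k $ k"
    using U by (simp add: unitary_def)
  then have "cinner (column k U) (A *v column k U) = complex_of_real (d k)"
    by (simp add: dagger_mult_mult_nth real_diag_def)
  then show ?thesis by (metis Re_cinner Re_complex_of_real)
qed

text \<open>An eigenbasis of \<rho> supplies the vectors and its eigenvalues the weights. Trace
  inequalities against \<rho> thereby reduce to inequalities between quadratic forms.\<close>

lemma psd_trace_expansion:
  fixes \<rho> :: "('n::finite) cmat"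
  assumes "psd \<rho>"
  obtains p :: "'n \<Rightarrow> real" and v
  where "\<forall>k. 0 \<le> p k"
    and "\<forall>X. Re (trace (\<rho> ** X)) = (\<Sum>k\<in>UNIV. p k * (v k \<bullet> (X *v v k)))"
proof -
  have "hermitian \<rho>" using assms by (simp add: psd_def)
  then obtain U d where U: "unitary U" and \<rho>: "\<rho> = U ** real_diag d ** dagger U"
    by (rule hermitian_spectral)
  have "0 \<le> d k" for k
    using psd_inner[OF assms] eigenvalue_eq_inner[OF U \<rho>] by simp
  moreover have "Re (trace (\<rho> ** X)) = (\<Sum>k\<in>UNIV. d k * (column k U \<bullet> (X *v column k U)))" for X
    unfolding \<rho> trace_unitary_conjugate by (simp add: Re_cinner)
  ultimately show ?thesis
    by (intro that[of d "\<lambda>k. column k U"] allI)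
qed

lemma psd_trace_mult_nonneg:
  fixes \<rho> :: "('n::finite) cmat"
  assumes "psd \<rho>" and "psd X"
  shows "0 \<le> Re (trace (\<rho> ** X))"
proof -
  obtain p :: "'n \<Rightarrow> real" and v where "\<forall>k. 0 \<le> p k"
    and "\<forall>X. Re (trace (\<rho> ** X)) = (\<Sum>k\<in>UNIV. p k * (v k \<bullet> (X *v v k)))"
    by (rule psd_trace_expansion[OF assms(1)])
  then show ?thesis
    using psd_inner[OF assms(2)] by (simp add: sum_nonneg)
qed

text \<open>The weights form the spectral measure of \<open>v\<close>, which is independent of
  \<open>f\<close>; the same weights therefore serve the logarithm and all resolvents.\<close>

lemma inner_unitary_conjugate:
  "v \<bullet> ((U ** real_diag f ** dagger U) *v v) = (\<Sum>i\<in>UNIV. (cmod ((dagger U *v v) $ i))\<^sup>2 * f i)"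
proof -
  have "cinner v ((U ** real_diag f ** dagger U) *v v)
      = cinner (dagger U *v v) (real_diag f *v (dagger U *v v))"
    by (simp add: matrix_vector_mul_assoc matrix_mul_assoc cinner_dagger_left)
  then have "v \<bullet> ((U ** real_diag f ** dagger U) *v v)
      = (dagger U *v v) \<bullet> (real_diag f *v (dagger U *v v))"
    by (metis Re_cinner)
  moreover have "(real_diag f *v w) $ i = f i *\<^sub>R w $ i" for w i
    by (simp add: real_diag_def matrix_vector_mult_def if_distrib if_distribR scaleR_conv_of_real
        cong: if_cong)
  ultimately show ?thesis
    by (simp add: inner_vec_def power2_norm_eq_inner mult.commute)
qed

section \<open>Weighted sums of POVM elements and the inequality for inverses\<close>

lemma sum_matrix_vector_mult:
  fixes M :: "'z \<Rightarrow> complex ^ 'm ^ 'n"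
  shows "(\<Sum>z\<in>Z. c z *\<^sub>R M z) *v v = (\<Sum>z\<in>Z. c z *\<^sub>R (M z *v v))"
  by (induction Z rule: infinite_finite_induct)
     (simp_all add: matrix_vector_mult_add_rdistrib matrix_vector_mult_scaleR_complex)

lemma POVM_sum_apply:
  assumes "POVM (Z, M)"
  shows "(\<Sum>z\<in>Z. M z *v v) = v"
  using assms sum_matrix_vector_mult[of "\<lambda>_. 1" M Z v] by simp

text \<open>
  The sum of the nonnegative numbers \<open>(e z w - v) \<bullet> M z (e z w - v) / e z\<close> is
  \<open>w \<bullet> W w - 2 w \<bullet> v + (\<Sum>z\<in>Z. v \<bullet> M z v / e z)\<close> with \<open>W = \<Sum>z\<in>Z. e z M z\<close>.
\<close>

lemma POVM_inverse_jensen: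
  assumes M: "POVM (Z, M)" and e: "\<And>z. z \<in> Z \<Longrightarrow> 0 < e z"
    and w: "(\<Sum>z\<in>Z. e z *\<^sub>R (M z *v w)) = v"
  shows "w \<bullet> v \<le> (\<Sum>z\<in>Z. (v \<bullet> (M z *v v)) / e z)"
proof -
  have "0 \<le> (\<Sum>z\<in>Z. ((e z *\<^sub>R w - v) \<bullet> (M z *v (e z *\<^sub>R w - v))) / e z)"
    using M by (intro sum_nonneg divide_nonneg_pos e) (auto intro!: psd_inner)
  also have "\<dots> = (\<Sum>z\<in>Z. w \<bullet> (e z *\<^sub>R (M z *v w)) - 2 * (w \<bullet> (M z *v v)) + (v \<bullet> (M z *v v)) / e z)"
  proof (rule sum.cong)
    fix z assume z: "z \<in> Z"
    then have "hermitian (M z)" using M by (simp add: psd_def)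
    then have "v \<bullet> (M z *v w) = w \<bullet> (M z *v v)"
      by (metis hermitian_inner inner_commute)
    then show "((e z *\<^sub>R w - v) \<bullet> (M z *v (e z *\<^sub>R w - v))) / e z
        = w \<bullet> (e z *\<^sub>R (M z *v w)) - 2 * (w \<bullet> (M z *v v)) + (v \<bullet> (M z *v v)) / e z"
      using e[OF z] by (simp add: matrix_vector_mult_diff_distrib matrix_vector_mult_scaleR_complex
          inner_diff_left inner_diff_right field_simps)
  qed simp
  also have "\<dots> = w \<bullet> v - 2 * (w \<bullet> v) + (\<Sum>z\<in>Z. (v \<bullet> (M z *v v)) / e z)"
    by (simp add: sum.distrib sum_subtractf POVM_sum_apply[OF M] del: inner_scaleR_right
        flip: sum_distrib_left inner_sum_right) (simp add: w)
  finally show ?thesis by simp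
qed

text \<open>
  Differentiate \<open>\<Sum>i\<in>I. a i * ln (d i + s) - (\<Sum>z\<in>Z. m z * ln (c z + s))\<close> in \<open>s\<close>: it decreases,
  and it tends to \<open>0\<close> at infinity because the total masses agree.
\<close>

lemma resolvent_le_imp_ln_ge:
  fixes a d :: "'i \<Rightarrow> real" and m c :: "'z \<Rightarrow> real"
  assumes d: "\<And>i. i \<in> I \<Longrightarrow> 0 < d i" and c: "\<And>z. z \<in> Z \<Longrightarrow> 0 < c z"
    and mass: "sum a I = sum m Z"
    and le: "\<And>s. 0 \<le> s \<Longrightarrow> (\<Sum>i\<in>I. a i / (d i + s)) \<le> (\<Sum>z\<in>Z. m z / (c z + s))"
  shows "(\<Sum>z\<in>Z. m z * ln (c z)) \<le> (\<Sum>i\<in>I. a i * ln (d i))"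
proof -
  define g where "g s = (\<Sum>i\<in>I. a i * ln (d i + s)) - (\<Sum>z\<in>Z. m z * ln (c z + s))" for s
  have deriv: "(g has_real_derivative (\<Sum>i\<in>I. a i / (d i + s)) - (\<Sum>z\<in>Z. m z / (c z + s))) (at s)"
    if "0 \<le> s" for s
    unfolding g_def using that d c
    by (auto intro!: derivative_eq_intros sum.cong simp: add_pos_nonneg divide_inverse mult.commute)
  have "g s \<le> g 0" if "0 \<le> s" for s
    using that by (rule DERIV_nonpos_imp_nonincreasing) (use deriv le in fastforce)
  moreover have "(g \<longlongrightarrow> 0) at_top"
  proof -
    \<comment> \<open>Each logarithm diverges, so \<open>ln (1 + s)\<close> is subtracted
      throughout; equal masses make these corrections cancel between the two sums.\<close>
    have lim: "((\<lambda>s. ln (x + s) - ln (1 + s)) \<longlongrightarrow> 0) at_top" for x :: real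
      by real_asymp
    have "g = (\<lambda>s. (\<Sum>i\<in>I. a i * (ln (d i + s) - ln (1 + s)))
        - (\<Sum>z\<in>Z. m z * (ln (c z + s) - ln (1 + s))))"
      by (simp add: g_def fun_eq_iff right_diff_distrib sum_subtractf mass flip: sum_distrib_right)
    moreover have "((\<lambda>s. (\<Sum>i\<in>I. a i * (ln (d i + s) - ln (1 + s)))
        - (\<Sum>z\<in>Z. m z * (ln (c z + s) - ln (1 + s)))) \<longlongrightarrow> (\<Sum>i\<in>I. a i * 0) - (\<Sum>z\<in>Z. m z * 0)) at_top"
      by (intro tendsto_intros lim)
    ultimately show ?thesis by simp
  qed
  ultimately have "0 \<le> g 0"
    by (intro tendsto_upperbound[of g 0 at_top]) (auto intro: eventually_at_top_linorderI[of 0])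
  then show ?thesis by (simp add: g_def)
qed

section \<open>Full support and functional calculus under unitary conjugation\<close>

lemma POVM_sum_full_support:
  assumes M: "POVM (Z, M)" and c: "\<And>z. z \<in> Z \<Longrightarrow> 0 < c z"
  shows "psd_full_support (\<Sum>z\<in>Z. c z *\<^sub>R M z)"
proof -
  have pos: "0 \<le> v \<bullet> (M z *v v)" if "z \<in> Z" for z v
    using M that by (auto intro: psd_inner)
  have form: "v \<bullet> ((\<Sum>z\<in>Z. c z *\<^sub>R M z) *v v) = (\<Sum>z\<in>Z. c z * (v \<bullet> (M z *v v)))" for v
    by (simp add: sum_matrix_vector_mult inner_sum_right)
  have summand: "0 \<le> c z * (v \<bullet> (M z *v v))" if "z \<in> Z" for z v
    using c[OF that] pos[OF that] by simp
  have "dagger (\<Sum>z\<in>Z. c z *\<^sub>R M z) = (\<Sum>z\<in>Z. c z *\<^sub>R dagger (M z))"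
    by (simp add: vec_eq_iff dagger_nth)
  also have "\<dots> = (\<Sum>z\<in>Z. c z *\<^sub>R M z)"
    using M by (intro sum.cong) (auto simp: psd_def hermitian_def)
  finally have "psd (\<Sum>z\<in>Z. c z *\<^sub>R M z)"
    using summand by (simp add: psd_def hermitian_def Re_cinner form sum_nonneg)
  moreover have "v = 0" if "(\<Sum>z\<in>Z. c z *\<^sub>R M z) *v v = 0" for v
  proof -
    \<comment> \<open>A sum of nonnegative terms vanishes only termwise. Dividing out the positive
      weights leaves every \<open>v \<bullet> (M z *v v)\<close> zero, and these add up to
      \<open>v \<bullet> v\<close>.\<close>
    have "(\<Sum>z\<in>Z. c z * (v \<bullet> (M z *v v))) = 0"
      using form[of v] that by simp
    then have "\<forall>z\<in>Z. c z * (v \<bullet> (M z *v v)) = 0"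
      using M summand by (subst (asm) sum_nonneg_eq_0_iff) auto
    then have "(\<Sum>z\<in>Z. v \<bullet> (M z *v v)) = 0"
      using c by (intro sum.neutral) force
    then show ?thesis
      by (simp add: POVM_sum_apply[OF M] flip: inner_sum_right)
  qed
  ultimately show ?thesis by (simp add: psd_full_support_def)
qed

text \<open>A zero eigenvalue would put the corresponding column of \<open>U\<close>, which is
  nonzero, into the kernel.\<close>

lemma psd_full_support_spectral:
  assumes "psd_full_support A"
  obtains U d where "unitary U" "A = U ** real_diag d ** dagger U" "\<forall>i. 0 < d i"
proof -
  have "psd A" "hermitian A" using assms by (simp_all add: psd_full_support_def psd_def)
  then obtain U d where U: "unitary U" and A: "A = U ** real_diag d ** dagger U"
    using hermitian_spectral by blast
  have "0 < d i" for i
  proof (rule ccontr)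
    assume "\<not> 0 < d i"
    then have "d i = 0"
      using eigenvalue_eq_inner[OF U A, of i] psd_inner[OF \<open>psd A\<close>, of "column i U"] by simp
    then have "real_diag d *v axis i 1 = 0"
      by (auto simp: vec_eq_iff real_diag_def matrix_vector_mult_def axis_def intro!: sum.neutral)
    moreover have "A ** U = U ** real_diag d"
      using U by (simp only: A unitary_def matrix_mul_assoc[symmetric] matrix_mul_rid)
    ultimately have "A *v (U *v axis i 1) = 0"
      by (metis matrix_vector_mul_assoc matrix_vector_mult_0_right)
    then have "U *v axis i 1 = 0"
      using assms by (simp add: psd_full_support_def)
    then have "dagger U *v (U *v axis i 1) = 0" by simp
    then show False
      using U by (simp add: unitary_def matrix_vector_mul_assoc axis_eq_0_iff)
  qed
  with U A that show ?thesis by blast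
qed

lemma unitary_conjugate_const:
  assumes "unitary U"
  shows "U ** real_diag (\<lambda>_. s) ** dagger U = s *\<^sub>R mat 1"
proof -
  have "U ** real_diag (\<lambda>_. s) = s *\<^sub>R U"
    by (simp add: vec_eq_iff real_diag_mult_nth) (simp add: scaleR_conv_of_real)
  then show ?thesis using assms by (simp add: unitary_def flip: scalar_matrix_assoc)
qed

lemma matrix_add_rdistrib: "(A + B) ** C = A ** C + B ** C"
  by (simp add: matrix_matrix_mult_def vec_eq_iff distrib_right sum.distrib)

lemma unitary_conjugate_add:
  "U ** real_diag f ** dagger U + U ** real_diag g ** dagger U
    = U ** real_diag (\<lambda>i. f i + g i) ** dagger U"
proof -
  have "real_diag (\<lambda>i. f i + g i) = real_diag f + real_diag g"
    by (simp add: vec_eq_iff real_diag_def)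
  then show ?thesis
    by (simp add: matrix_add_ldistrib matrix_add_rdistrib)
qed

lemma unitary_conjugate_mult:
  assumes "unitary U"
  shows "(U ** real_diag f ** dagger U) ** (U ** real_diag g ** dagger U)
    = U ** real_diag (\<lambda>i. f i * g i) ** dagger U"
proof -
  have "(U ** real_diag f ** dagger U) ** (U ** real_diag g ** dagger U)
      = U ** (real_diag f ** (dagger U ** U) ** real_diag g) ** dagger U"
    by (simp only: matrix_mul_assoc)
  moreover have "real_diag f ** real_diag g = real_diag (\<lambda>i. f i * g i)"
    by (simp add: vec_eq_iff real_diag_mult_nth) (simp add: real_diag_def)
  ultimately show ?thesis using assms by (simp add: unitary_def)
qed

text \<open>Both sides are integrals of \<open>ln\<close>, against the spectral measure of
  \<open>v\<close> and against the masses \<open>v \<bullet> (M z *v v)\<close>, so the scalar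
  comparison of resolvents applies.\<close>

lemma POVM_log_jensen_vector:
  assumes M: "POVM (Z, M)" and c: "\<And>z. z \<in> Z \<Longrightarrow> 0 < c z"
  shows "(\<Sum>z\<in>Z. (v \<bullet> (M z *v v)) * ln (c z)) \<le> v \<bullet> (mat_log (\<Sum>z\<in>Z. c z *\<^sub>R M z) *v v)"
proof -
  let ?\<omega> = "\<Sum>z\<in>Z. c z *\<^sub>R M z"
  obtain U d where U: "unitary U" and \<omega>: "?\<omega> = U ** real_diag d ** dagger U" and d: "\<forall>i. 0 < d i"
    by (rule psd_full_support_spectral[OF POVM_sum_full_support[OF M c]])
  define a where "a i = (cmod ((dagger U *v v) $ i))\<^sup>2" for i
  have conj: "v \<bullet> ((U ** real_diag f ** dagger U) *v v) = (\<Sum>i\<in>UNIV. a i * f i)" for f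
    unfolding a_def by (rule inner_unitary_conjugate)
  have "(\<Sum>z\<in>Z. (v \<bullet> (M z *v v)) * ln (c z)) \<le> (\<Sum>i\<in>UNIV. a i * ln (d i))"
  proof (rule resolvent_le_imp_ln_ge)
    \<comment> \<open>The constant function \<open>1\<close> gives the total mass of the spectral
      measure.\<close>
    have "sum a UNIV = v \<bullet> v"
      using conj[of "\<lambda>_. 1"] by (simp add: unitary_conjugate_const[OF U])
    also have "\<dots> = (\<Sum>z\<in>Z. v \<bullet> (M z *v v))"
      by (simp add: POVM_sum_apply[OF M] flip: inner_sum_right)
    finally show "sum a UNIV = (\<Sum>z\<in>Z. v \<bullet> (M z *v v))" .
  next
    fix s :: real assume s: "0 \<le> s"
    \<comment> \<open>This is the resolvent of the weighted sum at \<open>- s\<close> applied to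
      \<open>v\<close>. Since the POVM sums to \<open>mat 1\<close>, shifting the sum by
      \<open>s\<close> just shifts all weights to \<open>c z + s\<close>.\<close>
    define w where "w = (U ** real_diag (\<lambda>i. 1 / (d i + s)) ** dagger U) *v v"
    have ds: "d i + s \<noteq> 0" for i using d[rule_format, of i] s by simp
    have "(\<Sum>z\<in>Z. (c z + s) *\<^sub>R M z) = ?\<omega> + s *\<^sub>R mat 1"
      using M by (simp add: scaleR_add_left sum.distrib flip: scaleR_sum_right)
    also have "\<dots> = U ** real_diag (\<lambda>i. d i + s) ** dagger U"
      by (simp add: \<omega> unitary_conjugate_add flip: unitary_conjugate_const[OF U])
    finally have "(\<Sum>z\<in>Z. (c z + s) *\<^sub>R (M z *v w))
        = (U ** real_diag (\<lambda>i. d i + s) ** dagger U) *v w"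
      by (simp only: sum_matrix_vector_mult[symmetric])
    also have "\<dots> = v"
      by (simp add: w_def matrix_vector_mul_assoc unitary_conjugate_mult[OF U] ds
          unitary_conjugate_const[OF U])
    finally have "(\<Sum>z\<in>Z. (c z + s) *\<^sub>R (M z *v w)) = v" .
    with M have "w \<bullet> v \<le> (\<Sum>z\<in>Z. (v \<bullet> (M z *v v)) / (c z + s))"
      using c s by (intro POVM_inverse_jensen) (auto intro: add_pos_nonneg)
    then show "(\<Sum>i\<in>UNIV. a i / (d i + s)) \<le> (\<Sum>z\<in>Z. (v \<bullet> (M z *v v)) / (c z + s))"
      by (simp add: w_def inner_commute[of _ v] conj)
  qed (use c d in auto)
  then show ?thesis
    by (simp add: mat_log_def hermitian_fun_eq[OF U \<omega>] conj)
qed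

lemma POVM_log_jensen:
  fixes \<rho> :: "('n::finite) cmat"
  assumes M: "POVM (Z, M)" and c: "\<And>z. z \<in> Z \<Longrightarrow> 0 < c z" and \<rho>: "psd \<rho>"
  shows "(\<Sum>z\<in>Z. outcome_prob \<rho> M z * ln (c z))
    \<le> Re (trace (\<rho> ** mat_log (\<Sum>z\<in>Z. c z *\<^sub>R M z)))"
proof -
  obtain p :: "'n \<Rightarrow> real" and v where p: "\<forall>k. 0 \<le> p k"
    and tr: "\<forall>X. Re (trace (\<rho> ** X)) = (\<Sum>k\<in>UNIV. p k * (v k \<bullet> (X *v v k)))"
    by (rule psd_trace_expansion[OF \<rho>])
  have "(\<Sum>z\<in>Z. outcome_prob \<rho> M z * ln (c z))
      = (\<Sum>k\<in>UNIV. p k * (\<Sum>z\<in>Z. (v k \<bullet> (M z *v v k)) * ln (c z)))"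
    by (simp add: outcome_prob_def tr sum_distrib_left sum_distrib_right mult.assoc)
      (rule sum.swap)
  also have "\<dots> \<le> Re (trace (\<rho> ** mat_log (\<Sum>z\<in>Z. c z *\<^sub>R M z)))"
    unfolding tr[rule_format] by (intro sum_mono mult_left_mono p[rule_format] POVM_log_jensen_vector[OF M c])
  finally show ?thesis .
qed

section \<open>The variational bound\<close>

lemma trace_mult_sum_eq_outcome_prob:
  "Re (trace (\<sigma> ** (\<Sum>z\<in>Z. c z *\<^sub>R M z))) = (\<Sum>z\<in>Z. c z * outcome_prob \<sigma> M z)"
proof -
  have "trace (r *\<^sub>R X) = r *\<^sub>R trace X" for r and X :: "'a cmat"
    by (simp add: trace_def scaleR_sum_right)
  then show ?thesis
    by (induction Z rule: infinite_finite_induct)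
      (simp_all add: matrix_add_ldistrib trace_add matrix_scalar_ac outcome_prob_def trace_def[of 0]
        flip: scalar_matrix_assoc)
qed

lemma sum_outcome_prob:
  assumes "POVM (Z, M)"
  shows "(\<Sum>z\<in>Z. outcome_prob \<sigma> M z) = Re (trace \<sigma>)"
  using assms trace_mult_sum_eq_outcome_prob[of \<sigma> "\<lambda>_. 1" M Z] by simp

lemma elog_pos: "0 < x \<Longrightarrow> elog x = ereal (ln x)"
  by (simp add: elog_def)

text \<open>
  The optimal weights are \<open>c = P / Q\<close>. Outcomes with \<open>P z = 0\<close> get weight \<open>e\<close>, which then tends to
  \<open>0\<close>; outcomes with \<open>Q z = 0 < P z\<close> get a weight that tends to infinity.
\<close>

lemma rel_entropy_le_if_weights_le:
  fixes P Q :: "'z \<Rightarrow> real"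
  assumes Z: "finite Z" and P: "\<And>z. z \<in> Z \<Longrightarrow> 0 \<le> P z" and Q: "\<And>z. z \<in> Z \<Longrightarrow> 0 \<le> Q z"
    and P1: "sum P Z = 1"
    and bound: "\<And>c. (\<And>z. z \<in> Z \<Longrightarrow> 0 < c z) \<Longrightarrow>
      ereal (\<Sum>z\<in>Z. P z * ln (c z)) - elog (\<Sum>z\<in>Z. c z * Q z) \<le> B"
  shows "rel_entropy Z P Q \<le> B"
proof (cases "\<exists>z\<in>Z. P z > 0 \<and> Q z = 0")
  case False
  \<comment> \<open>The \<open>Q\<close>-mass of the outcomes where \<open>P\<close> vanishes; with
    weight \<open>e\<close> there, the normalisation becomes \<open>1 + e * K\<close>.\<close>
  define K where "K = (\<Sum>z\<in>Z. if P z > 0 then 0 else Q z)"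
  define S where "S = (\<Sum>z\<in>Z. P z * ln (P z / Q z))"
  have "0 \<le> K" unfolding K_def using Q by (intro sum_nonneg) auto
  have le: "ereal (S - ln (1 + e * K)) \<le> B" if e: "0 < e" for e
  proof -
    define c where "c z = (if P z > 0 then P z / Q z else e)" for z
    have Qpos: "0 < Q z" if "z \<in> Z" "0 < P z" for z
      using False Q[of z] that by fastforce
    have "0 < c z" if "z \<in> Z" for z
      using e Qpos[of z] that by (simp add: c_def)
    note bound[of c, OF this]
    moreover have "(\<Sum>z\<in>Z. P z * ln (c z)) = S"
      unfolding S_def c_def using P by (intro sum.cong) (auto simp: less_le)
    moreover have "(\<Sum>z\<in>Z. c z * Q z) = (\<Sum>z\<in>Z. P z + e * (if P z > 0 then 0 else Q z))"
      using P Qpos by (intro sum.cong) (force simp: c_def less_le)+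
    then have "(\<Sum>z\<in>Z. c z * Q z) = 1 + e * K"
      by (simp add: sum.distrib P1 K_def flip: sum_distrib_left)
    moreover have "0 < 1 + e * K"
      using e \<open>0 \<le> K\<close> by (simp add: add_pos_nonneg)
    ultimately show ?thesis
      by (simp add: elog_pos)
  qed
  have "((\<lambda>e. ereal (S - ln (1 + e * K))) \<longlongrightarrow> ereal (S - ln (1 + 0 * K))) (at_right 0)"
    by (intro tendsto_intros) auto
  then have lim: "((\<lambda>e. ereal (S - ln (1 + e * K))) \<longlongrightarrow> ereal S) (at_right 0)"
    by simp
  have "ereal S \<le> B"
    by (rule tendsto_upperbound[OF lim])
      (auto intro: eventually_mono[OF eventually_at_right_less] le)
  then show ?thesis using False by (simp only: rel_entropy_def S_def if_False)
next
  case True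
  define T where "T = {z \<in> Z. P z > 0 \<and> Q z = 0}"
  define p where "p = sum P T"
  have "0 < p" unfolding p_def using True Z by (intro sum_pos) (auto simp: T_def)
  define K where "K = sum Q Z"
  have "0 \<le> K" unfolding K_def using Q by (simp add: sum_nonneg)
  have le: "ereal (p * ln t) - elog K \<le> B" if t: "0 < t" for t
  proof -
    \<comment> \<open>Outside \<open>T\<close> the logarithm is \<open>ln 1 = 0\<close>, and on
      \<open>T\<close> the factor \<open>Q z\<close> is \<open>0\<close>, so \<open>t\<close> enters
      only through \<open>p * ln t\<close>.\<close>
    define c where "c z = (if z \<in> T then t else 1)" for z
    have "0 < c z" for z using t by (simp add: c_def)
    note bound[of c, OF this]
    moreover have "(\<Sum>z\<in>Z. P z * ln (c z)) = (\<Sum>z\<in>T. P z * ln t)"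
      using Z by (intro sum.mono_neutral_cong_right) (auto simp: c_def T_def)
    moreover have "(\<Sum>z\<in>Z. c z * Q z) = K"
      unfolding K_def by (intro sum.cong) (auto simp: c_def T_def)
    ultimately show ?thesis by (simp add: p_def sum_distrib_right)
  qed
  have "B = \<infinity>"
  proof (cases "K = 0")
    case True
    \<comment> \<open>Here \<open>elog K\<close> is \<open>-\<infinity>\<close>, so a single bound
      already forces \<open>B = \<infinity>\<close>.\<close>
    then show ?thesis using le[of 1] by (simp add: elog_def)
  next
    case False
    then have "0 < K" using \<open>0 \<le> K\<close> by simp
    have "ereal b \<le> B" for b
      \<comment> \<open>This \<open>t\<close> solves \<open>p * ln t - ln K = b\<close>.\<close>
      using le[of "exp ((b + ln K) / p)"] \<open>0 < p\<close> by (simp add: elog_pos[OF \<open>0 < K\<close>])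
    then show ?thesis by (rule ereal_top)
  qed
  then show ?thesis by simp
qed

theorem lemma3:
  fixes \<M> :: "('z set \<times> ('z \<Rightarrow> complex ^ 'n::finite ^ 'n)) set"
    and \<rho> \<sigma> :: "complex ^ 'n ^ 'n"
  assumes "\<forall>M\<in>\<M>. POVM M"
    and "quantum_state \<rho>"
    and "psd \<sigma>"
  shows "measured_rel_entropy \<M> \<rho> \<sigma>
    \<le> (SUP \<omega> \<in> {\<omega>. psd_full_support \<omega> \<and> \<omega> \<in> cone_union \<M>}.
          ereal (Re (trace (\<rho> ** mat_log \<omega>))) - elog (Re (trace (\<sigma> ** \<omega>))))"
    (is "_ \<le> (SUP \<omega> \<in> ?C. ?g \<omega>)")
proof -
  have \<rho>: "psd \<rho>" "trace \<rho> = 1" using assms(2) by (simp_all add: quantum_state_def)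
  have "rel_entropy Z (outcome_prob \<rho> M) (outcome_prob \<sigma> M) \<le> (SUP \<omega> \<in> ?C. ?g \<omega>)"
    if ZM: "(Z, M) \<in> \<M>" for Z M
  proof (rule rel_entropy_le_if_weights_le)
    have POVM: "POVM (Z, M)" using assms(1) ZM by blast
    then show "finite Z" by simp
    show "0 \<le> outcome_prob \<rho> M z" "0 \<le> outcome_prob \<sigma> M z" if "z \<in> Z" for z
      using POVM that \<rho>(1) assms(3) by (simp_all add: outcome_prob_def psd_trace_mult_nonneg)
    show "sum (outcome_prob \<rho> M) Z = 1"
      by (simp add: sum_outcome_prob[OF POVM] \<rho>(2))
    fix c :: "'z \<Rightarrow> real" assume c: "\<And>z. z \<in> Z \<Longrightarrow> 0 < c z"
    let ?\<omega> = "\<Sum>z\<in>Z. c z *\<^sub>R M z"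
    have "?\<omega> \<in> cone_of (Z, M)"
      using c by (auto intro!: exI[of _ c] less_imp_le)
    then have "?\<omega> \<in> ?C"
      using ZM POVM_sum_full_support[OF POVM c] by (auto simp: cone_union_def simp del: cone_of.simps)
    then have "?g ?\<omega> \<le> (SUP \<omega> \<in> ?C. ?g \<omega>)"
      by (rule SUP_upper)
    \<comment> \<open>The \<open>elog\<close> terms agree by linearity of the trace; Jensen's
      inequality is used only in the \<rho> term.\<close>
    moreover have "ereal (\<Sum>z\<in>Z. outcome_prob \<rho> M z * ln (c z))
        - elog (\<Sum>z\<in>Z. c z * outcome_prob \<sigma> M z) \<le> ?g ?\<omega>"
      using POVM_log_jensen[OF POVM c \<rho>(1)]
      by (intro ereal_minus_mono) (simp_all add: trace_mult_sum_eq_outcome_prob)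
    ultimately show "ereal (\<Sum>z\<in>Z. outcome_prob \<rho> M z * ln (c z))
        - elog (\<Sum>z\<in>Z. c z * outcome_prob \<sigma> M z) \<le> (SUP \<omega> \<in> ?C. ?g \<omega>)"
      by (rule order_trans[rotated])
  qed
  then show ?thesis
    unfolding measured_rel_entropy_def by (auto intro!: SUP_least)
qed

end
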